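(* Let $(X,d)$ be a Polish metric space (separable and complete). A typical compact set $K\in\mathcal{K}(X)$ is a generalized fractal with the following property: for every $r\in(0,1)$ there exists a GIFS$_\infty$ $\mathcal{F}$ defined on $\ell_\infty(K)$ that witnesses that $K$ is a generalized fractal and satisfies $\operatorname{Lip}(f)\le r$ for every $f\in\mathcal{F}$. That is, the set of all such $K$ is co-meager in $\mathcal{K}(X)$.
   Context: For a metric space $(X,d)$, $\mathcal{K}(X)$ is the space of nonempty compact subsets of $X$ with the Hausdorff metric (complete if $X$ is complete); for $A\subset X$, $\mathcal{K}(A)$ is the subspace of nonempty compact subsets of $A$. A typical element of a complete metric space has a property if the set of elements having that property is co-meager (its complement is meager, i.e. a countable union of nowhere dense sets). For $A\subset X$, $\ell_\infty(A)$ is the set of all bounded sequences of elements of $A$, with the supremum metric $d_1((x_k),(y_k))=\sup_k d(x_k,y_k)$; for compact $A$ it equals the full product $A\times A\times\cdots$. $\ell_\infty(\mathcal{K}(A))$ is the set of sequences in $\mathcal{K}(A)$ bounded in the Hausdorff metric. $\operatorname{Lip}(f)$ denotes the (least) Lipschitz constant of $f$, and $f$ is a contraction if $\operatorname{Lip}(f)<1$. A GIFS$_\infty$ defined on $\ell_\infty(A)$ is a finite family $\mathcal{F}=\{f_1,\dots,f_p\}$ of contractions $f_i:\ell_\infty(A)\to X$ such that (condition (C1)) for every $(K_k)\in\ell_\infty(\mathcal{K}(A))$ the closure $\overline{f_i(\prod_{k=1}^\infty K_k)}$ is in $\mathcal{K}(X)$. A set $A\in\mathcal{K}(X)$ is a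 generalized fractal if there is a GIFS$_\infty$ $\mathcal{F}=\{f_1,\dots,f_p\}$ defined on $\ell_\infty(A)$ with $A=\bigcup_{i=1}^p\overline{f_i(A\times A\times\cdots)}$; such an $\mathcal{F}$ is said to witness that $A$ is a generalized fractal. *)

theory Defs
  imports "HOL-Analysis.Analysis"
begin

section \<open>The hyperspace of nonempty compact sets\<close>

typedef (overloaded) 'a kset = "{K :: 'a::metric_space set. compact K \<and> K \<noteq> {}}"
  morphisms set_of_kset Abs_kset
  by (rule exI[of _ "{undefined}"]) auto

lemma compact_set_of_kset [simp]: "compact (set_of_kset K)"
  and set_of_kset_nonempty [simp]: "set_of_kset K \<noteq> {}"
  using set_of_kset[of K] by auto

definition hausdorff_dist :: "'a::metric_space set \<Rightarrow> 'a set \<Rightarrow> real" where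
  "hausdorff_dist A B = max (SUP a\<in>A. infdist a B) (SUP b\<in>B. infdist b A)"

lemma hausdorff_dist_commute: "hausdorff_dist A B = hausdorff_dist B A"
  by (simp add: hausdorff_dist_def max.commute)

lemma infdist_le_hausdorff_dist:
  assumes "compact A" "a \<in> A"
  shows "infdist a B \<le> hausdorff_dist A B"
proof -
  have "compact ((\<lambda>a. infdist a B) ` A)"
    by (intro compact_continuous_image continuous_intros assms)
  then have "bdd_above ((\<lambda>a. infdist a B) ` A)"
    by (intro bounded_imp_bdd_above compact_imp_bounded)
  then have "infdist a B \<le> (SUP a\<in>A. infdist a B)"
    using assms by (intro cSUP_upper)
  then show ?thesis
    by (simp add: hausdorff_dist_def)
qed

lemma hausdorff_dist_le:
  assumes "A \<noteq> {}" "B \<noteq> {}"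
    and "\<And>a. a \<in> A \<Longrightarrow> infdist a B \<le> e" "\<And>b. b \<in> B \<Longrightarrow> infdist b A \<le> e"
  shows "hausdorff_dist A B \<le> e"
  using assms by (auto simp: hausdorff_dist_def intro!: cSUP_least)

lemma infdist_le_infdist_plus_hausdorff_dist:
  assumes "compact B" "B \<noteq> {}"
  shows "infdist a C \<le> infdist a B + hausdorff_dist B C"
proof -
  have "continuous_on B (dist a)"
    by (intro continuous_intros)
  then obtain b where b: "b \<in> B" "\<And>y. y \<in> B \<Longrightarrow> dist a b \<le> dist a y"
    using continuous_attains_inf[OF assms, of "dist a"] by auto
  have "dist a b \<le> infdist a B"
    unfolding infdist_notempty[OF assms(2)] using assms(2) b(2) by (rule cINF_greatest)
  moreover have "infdist a C \<le> infdist b C + dist a b"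
    by (rule infdist_triangle)
  moreover have "infdist b C \<le> hausdorff_dist B C"
    by (rule infdist_le_hausdorff_dist) (use assms b in auto)
  ultimately show ?thesis by linarith
qed

lemma hausdorff_dist_triangle:
  assumes "compact A" "compact B" "compact C" "A \<noteq> {}" "B \<noteq> {}" "C \<noteq> {}"
  shows "hausdorff_dist A C \<le> hausdorff_dist A B + hausdorff_dist B C"
proof (rule hausdorff_dist_le)
  fix a assume "a \<in> A"
  then show "infdist a C \<le> hausdorff_dist A B + hausdorff_dist B C"
    using infdist_le_infdist_plus_hausdorff_dist[OF assms(2,5), of a C]
      infdist_le_hausdorff_dist[OF assms(1), of a B] by linarith
next
  fix c assume "c \<in> C"
  then show "infdist c A \<le> hausdorff_dist A B + hausdorff_dist B C"
    using infdist_le_infdist_plus_hausdorff_dist[OF assms(2,5), of c A]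
      infdist_le_hausdorff_dist[OF assms(3), of c B]
    by (simp add: hausdorff_dist_commute[of B A] hausdorff_dist_commute[of C B])
qed (use assms in auto)

lemma hausdorff_dist_0D:
  assumes "compact A" "compact B" "B \<noteq> {}" "hausdorff_dist A B = 0"
  shows "A \<subseteq> B"
proof
  fix a assume "a \<in> A"
  then have "infdist a B = 0"
    using infdist_le_hausdorff_dist[OF assms(1), of a B] infdist_nonneg[of a B] assms(4)
    by simp
  then show "a \<in> B"
    using in_closed_iff_infdist_zero[of B a] assms(2,3) by (simp add: compact_imp_closed)
qed

instantiation kset :: (metric_space) metric_space
begin

definition dist_kset :: "'a kset \<Rightarrow> 'a kset \<Rightarrow> real" where
  "dist_kset K L = hausdorff_dist (set_of_kset K) (set_of_kset L)"

definition uniformity_kset :: "('a kset \<times> 'a kset) filter" where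
  "uniformity_kset = (INF e\<in>{0 <..}. principal {(x, y). dist x y < e})"

definition open_kset :: "'a kset set \<Rightarrow> bool" where
  "open_kset S = (\<forall>x\<in>S. \<forall>\<^sub>F (x', y) in uniformity. x' = x \<longrightarrow> y \<in> S)"

instance
proof
  fix K L M :: "'a kset"
  show "dist K L = 0 \<longleftrightarrow> K = L"
  proof
    assume *: "dist K L = 0"
    have "set_of_kset K \<subseteq> set_of_kset L"
      using * by (intro hausdorff_dist_0D) (auto simp: dist_kset_def)
    moreover have "set_of_kset L \<subseteq> set_of_kset K"
      using * by (intro hausdorff_dist_0D)
        (auto simp: dist_kset_def hausdorff_dist_commute[of "set_of_kset L"])
    ultimately show "K = L"
      by (simp add: set_of_kset_inject[symmetric])
  qed (simp add: dist_kset_def hausdorff_dist_def)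
  show "dist K L \<le> dist K M + dist L M"
    using hausdorff_dist_triangle[of "set_of_kset K" "set_of_kset M" "set_of_kset L"]
    by (simp add: dist_kset_def hausdorff_dist_commute[of "set_of_kset L"])
qed (rule open_kset_def uniformity_kset_def)+

end

definition ksets_in :: "'a::metric_space set \<Rightarrow> 'a kset set" where
  "ksets_in A = {K. set_of_kset K \<subseteq> A}"


section \<open>Baire category\<close>

definition nowhere_dense :: "'a::topological_space set \<Rightarrow> bool" where
  "nowhere_dense S \<longleftrightarrow> interior (closure S) = {}"

definition meager :: "'a::topological_space set \<Rightarrow> bool" where
  "meager S \<longleftrightarrow> (\<exists>\<N>. countable \<N> \<and> (\<forall>N\<in>\<N>. nowhere_dense N) \<and> S = \<Union>\<N>)"

definition comeager :: "'a::topological_space set \<Rightarrow> bool" where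
  "comeager S \<longleftrightarrow> meager (- S)"


section \<open>Generalized iterated function systems of infinite order\<close>

text \<open>Since \<^typ>\<open>nat\<close> carries the discrete topology, \<^typ>\<open>nat \<Rightarrow>\<^sub>C 'a\<close> consists of all
  bounded sequences, and its distance is the supremum of the coordinatewise distances.
  \<^const>\<open>PiC\<close> is the product of sets, restricted to such sequences.\<close>

definition linf :: "'a::metric_space set \<Rightarrow> (nat \<Rightarrow>\<^sub>C 'a) set" where
  "linf A = PiC UNIV (\<lambda>_. A)"

text \<open>Maps \<open>f : S \<rightarrow> X\<close> are modelled by total functions of which only the values on \<open>S\<close> matter.
  The Lipschitz constant is \<open>\<infinity>\<close> if \<open>f\<close> is not Lipschitz on \<open>S\<close>.\<close>

definition Lip :: "'a::metric_space set \<Rightarrow> ('a \<Rightarrow> 'b::metric_space) \<Rightarrow> ereal" where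
  "Lip S f = (INF L\<in>{L. L-lipschitz_on S f}. ereal L)"

lemma Lip_le_iff:
  assumes "0 \<le> r"
  shows "Lip S f \<le> ereal r \<longleftrightarrow> r-lipschitz_on S f"
proof
  assume "r-lipschitz_on S f"
  then show "Lip S f \<le> ereal r"
    unfolding Lip_def by (intro INF_lower) simp
next
  assume le: "Lip S f \<le> ereal r"
  show "r-lipschitz_on S f"
  proof (rule lipschitz_onI[OF _ assms])
    fix x y assume xy: "x \<in> S" "y \<in> S"
    have *: "dist (f x) (f y) \<le> (r + e) * dist x y" if "e > 0" for e
    proof -
      have "Lip S f < ereal (r + e)"
        using le that by (simp add: order.strict_trans1)
      then obtain L where "L-lipschitz_on S f" "L < r + e"
        unfolding Lip_def INF_less_iff by auto
      then show ?thesis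
        by (meson lipschitz_onD lipschitz_on_le less_imp_le xy)
    qed
    have "((\<lambda>e. (r + e) * dist x y) \<longlongrightarrow> (r + 0) * dist x y) (at_right 0)"
      by (intro tendsto_intros)
    moreover have "\<forall>\<^sub>F e in at_right 0. dist (f x) (f y) \<le> (r + e) * dist x y"
      using * by (auto simp: eventually_at_right_less intro: eventually_at_rightI[of 0 1])
    ultimately show "dist (f x) (f y) \<le> r * dist x y"
      using tendsto_lowerbound[of "\<lambda>e. (r + e) * dist x y" "(r + 0) * dist x y" "at_right 0"] by simp
  qed
qed

definition contraction_on :: "'a::metric_space set \<Rightarrow> ('a \<Rightarrow> 'b::metric_space) \<Rightarrow> bool" where
  "contraction_on S f \<longleftrightarrow> Lip S f < 1"

definition condition_C1 :: "'a::metric_space set \<Rightarrow> ((nat \<Rightarrow>\<^sub>C 'a) \<Rightarrow> 'a) \<Rightarrow> bool" where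
  "condition_C1 A f \<longleftrightarrow>
     (\<forall>K \<in> linf (ksets_in A).
        \<exists>C :: 'a kset. set_of_kset C = closure (f ` PiC UNIV (\<lambda>k. set_of_kset (apply_bcontfun K k))))"

definition GIFS_inf :: "'a::metric_space set \<Rightarrow> ((nat \<Rightarrow>\<^sub>C 'a) \<Rightarrow> 'a) set \<Rightarrow> bool" where
  "GIFS_inf A \<F> \<longleftrightarrow>
     finite \<F> \<and> \<F> \<noteq> {} \<and> (\<forall>f\<in>\<F>. contraction_on (linf A) f \<and> condition_C1 A f)"

definition witnesses_generalized_fractal ::
    "((nat \<Rightarrow>\<^sub>C 'a) \<Rightarrow> 'a) set \<Rightarrow> 'a::metric_space kset \<Rightarrow> bool" where
  "witnesses_generalized_fractal \<F> K \<longleftrightarrow>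
     GIFS_inf (set_of_kset K) \<F> \<and>
     set_of_kset K = (\<Union>f\<in>\<F>. closure (f ` linf (set_of_kset K)))"

definition generalized_fractal :: "'a::metric_space kset \<Rightarrow> bool" where
  "generalized_fractal K \<longleftrightarrow> (\<exists>\<F>. witnesses_generalized_fractal \<F> K)"

end

theory Submission
  imports Defs
begin

text \<open>If a compact set \<open>K\<close> splits as \<open>U \<union> V\<close> with gap \<open>e > 0\<close>, then the map sending a sequence
  in \<open>K\<close> to its \<open>{U, V}\<close>-itinerary separates no two sequences at distance less than \<open>e\<close>. Every
  function of the itinerary with values in a set of diameter at most \<open>r * e\<close> is therefore
  \<open>r\<close>-Lipschitz, and it can be chosen to run through a countable dense subset of any small piece
  of \<open>K\<close>. So split sets and, by constant maps, singletons are generalized fractals with arbitrarily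
  small Lipschitz constants. Splitting is an open property, and it holds for all finite sets with
  at least two points, which approximate every compact set that is not a singleton; hence the
  remaining compact sets form a nowhere dense set.\<close>

section \<open>Splitting by a gap, bounded sequences and finite nets\<close>

definition split_at :: "real \<Rightarrow> 'a::metric_space set \<Rightarrow> 'a set \<Rightarrow> 'a set \<Rightarrow> bool" where
  "split_at e K U V \<longleftrightarrow>
     K = U \<union> V \<and> U \<noteq> {} \<and> V \<noteq> {} \<and> (\<forall>u\<in>U. \<forall>v\<in>V. e \<le> dist u v)"

text \<open>For compact sets this is disconnectedness, put in quantitative form.\<close>

definition splits :: "'a::metric_space set \<Rightarrow> bool" where
  "splits K \<longleftrightarrow> (\<exists>e>0. \<exists>U V. split_at e K U V)"

lemma mem_linf_iff: "x \<in> linf A \<longleftrightarrow> (\<forall>k. apply_bcontfun x k \<in> A)"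
  by (auto simp: linf_def mem_PiC_iff)

text \<open>Continuity is automatic on the discrete domain, so a bounded range is enough.\<close>

lemma bounded_sequence_bcontfun:
  fixes x :: "nat \<Rightarrow> 'a::metric_space"
  assumes "bounded A" "\<And>k. x k \<in> A"
  obtains y where "apply_bcontfun y = x"
proof -
  have "x \<in> bcontfun"
    using assms by (auto simp: bcontfun_def intro: bounded_subset[of A])
  then show ?thesis
    using that Bcontfun_inverse by blast
qed

lemma compact_finite_net:
  fixes S :: "'a::metric_space set"
  assumes "compact S" "0 < e"
  obtains T where "finite T" "T \<subseteq> S" "S \<subseteq> (\<Union>t\<in>T. ball t e)"
  using assms seq_compact_imp_totally_bounded[of S] compact_eq_seq_compact_metric by metis

section \<open>Lipschitz self-maps as generalized iterated function systems\<close>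

lemma condition_C1_self_map:
  assumes "compact A" "f ` linf A \<subseteq> A"
  shows "condition_C1 A f"
  unfolding condition_C1_def
proof
  fix K assume K: "K \<in> linf (ksets_in A)"
  let ?P = "PiC UNIV (\<lambda>k. set_of_kset (apply_bcontfun K k))"
  have sub: "set_of_kset (apply_bcontfun K k) \<subseteq> A" for k
    using K by (simp add: mem_linf_iff ksets_in_def)
  \<comment> \<open>A choice of one point per set stays in the bounded set \<open>A\<close>, so it
    is a point of \<open>?P\<close>; this gives the nonemptiness that \<open>kset\<close>
    demands.\<close>
  have "\<exists>x. x \<in> set_of_kset (apply_bcontfun K k)" for k
    using set_of_kset_nonempty by blast
  then obtain x where x: "x k \<in> set_of_kset (apply_bcontfun K k)" for k
    by metis
  moreover obtain y where "apply_bcontfun y = x"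
    using bounded_sequence_bcontfun[OF compact_imp_bounded[OF assms(1)], of x] x sub by blast
  ultimately have "?P \<noteq> {}"
    by (force simp: mem_PiC_iff)
  moreover have "?P \<subseteq> linf A"
    using sub by (auto simp: mem_linf_iff mem_PiC_iff Pi_iff subset_iff)
  then have "f ` ?P \<subseteq> A"
    using assms(2) by blast
  then have "closure (f ` ?P) \<subseteq> A"
    using assms(1) by (simp add: closure_minimal compact_imp_closed)
  then have "compact (closure (f ` ?P))"
    using assms(1) compact_Int_closed[of A "closure (f ` ?P)"] by (simp add: Int_absorb1)
  ultimately show "\<exists>C. set_of_kset C = closure (f ` ?P)"
    by (intro exI[of _ "Abs_kset (closure (f ` ?P))"]) (auto simp: Abs_kset_inverse)
qed

text \<open>Reduces the goal to a covering by image closures: compactness of \<open>K\<close> yields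
  (C1), and its closedness the reverse inclusion.\<close>

lemma witnesses_generalized_fractal_self_maps:
  fixes K :: "'a::metric_space kset"
  assumes "finite \<F>" "r < 1"
    and lip: "\<And>f. f \<in> \<F> \<Longrightarrow> r-lipschitz_on (linf (set_of_kset K)) f"
    and self: "\<And>f. f \<in> \<F> \<Longrightarrow> f ` linf (set_of_kset K) \<subseteq> set_of_kset K"
    and cover: "set_of_kset K \<subseteq> (\<Union>f\<in>\<F>. closure (f ` linf (set_of_kset K)))"
  shows "\<exists>\<F>. witnesses_generalized_fractal \<F> K \<and>
    (\<forall>f\<in>\<F>. Lip (linf (set_of_kset K)) f \<le> ereal r)"
proof -
  have Lip: "\<forall>f\<in>\<F>. Lip (linf (set_of_kset K)) f \<le> ereal r"
    using lip lipschitz_on_nonneg Lip_le_iff by blast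
  have "contraction_on (linf (set_of_kset K)) f" if "f \<in> \<F>" for f
    unfolding contraction_on_def
    using Lip that assms(2) by (metis ereal_less(3) le_less_trans)
  moreover have "condition_C1 (set_of_kset K) f" if "f \<in> \<F>" for f
    by (rule condition_C1_self_map[OF compact_set_of_kset self[OF that]])
  moreover have "\<F> \<noteq> {}"
    using cover set_of_kset_nonempty[of K] by blast
  moreover have "closure (f ` linf (set_of_kset K)) \<subseteq> set_of_kset K" if "f \<in> \<F>" for f
    using self[OF that] by (simp add: closure_minimal compact_imp_closed)
  ultimately have "witnesses_generalized_fractal \<F> K"
    unfolding witnesses_generalized_fractal_def GIFS_inf_def
    using assms(1) cover by blast
  then show ?thesis
    using Lip by blast
qed

section \<open>Witnesses for split sets and singletons\<close>

lemma split_small_piece_image: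
  fixes K P :: "'a::{metric_space, second_countable_topology} set"
  assumes "bounded K" and split: "split_at e K U V" and "0 < e" "0 \<le> r"
    and "P \<noteq> {}" and diam: "\<And>p q. p \<in> P \<Longrightarrow> q \<in> P \<Longrightarrow> dist p q \<le> r * e"
  shows "\<exists>f. r-lipschitz_on (linf K) f \<and> f ` linf K \<subseteq> P \<and> P \<subseteq> closure (f ` linf K)"
proof -
  obtain D where D: "countable D" "D \<subseteq> P" "P \<subseteq> closure D"
    by (rule separable)
  then have "D \<noteq> {}"
    using \<open>P \<noteq> {}\<close> by auto
  \<comment> \<open>The only feature of the itinerary that is used is the first entry time into
    \<open>V\<close>. If \<open>V\<close> is never entered, \<open>LEAST\<close> is unspecified, but
    \<open>from_nat_into D\<close> maps every index into \<open>D\<close>.\<close>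
  define f where "f x = from_nat_into D (LEAST n. apply_bcontfun x n \<in> V)" for x
  have fD: "f x \<in> D" for x
    unfolding f_def by (rule from_nat_into[OF \<open>D \<noteq> {}\<close>])
  have gap: "(a \<in> V \<longleftrightarrow> b \<in> V)" if "a \<in> K" "b \<in> K" "dist a b < e" for a b
    using split that by (auto simp: split_at_def not_less[symmetric] dist_commute)
  have "r-lipschitz_on (linf K) f"
  proof (rule lipschitz_onI[OF _ \<open>0 \<le> r\<close>])
    fix x y assume xy: "x \<in> linf K" "y \<in> linf K"
    show "dist (f x) (f y) \<le> r * dist x y"
    proof (cases "dist x y < e")
      case True
      then have "apply_bcontfun x n \<in> V \<longleftrightarrow> apply_bcontfun y n \<in> V" for n
        using xy by (intro gap dist_fun_lt_imp_dist_val_lt) (auto simp: mem_linf_iff)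
      then have "f x = f y"
        by (simp add: f_def)
      then show ?thesis
        using \<open>0 \<le> r\<close> by simp
    next
      case False
      have "dist (f x) (f y) \<le> r * e"
        using fD D(2) by (intro diam) auto
      also have "\<dots> \<le> r * dist x y"
        using False \<open>0 \<le> r\<close> by (intro mult_left_mono) auto
      finally show ?thesis .
    qed
  qed
  moreover have "D \<subseteq> f ` linf K"
  proof
    fix d assume "d \<in> D"
    then obtain n where n: "from_nat_into D n = d"
      using from_nat_into_surj[OF D(1)] by blast
    obtain u v where uv: "u \<in> U" "v \<in> V"
      using split by (auto simp: split_at_def)
    then have "u \<notin> V"
      using split \<open>0 < e\<close> by (force simp: split_at_def)
    \<comment> \<open>A sequence that visits \<open>V\<close> at time \<open>n\<close> only, so that
      \<open>f\<close> takes the value with index \<open>n\<close>.\<close>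
    have K: "(if k = n then v else u) \<in> K" for k
      using uv split by (auto simp: split_at_def)
    obtain x where x: "apply_bcontfun x = (\<lambda>k. if k = n then v else u)"
      by (rule bounded_sequence_bcontfun[OF \<open>bounded K\<close> K])
    have "(LEAST k. apply_bcontfun x k \<in> V) = n"
      using uv(2) \<open>u \<notin> V\<close> by (intro Least_equality) (auto simp: x split: if_splits)
    then have "d = f x"
      by (simp add: f_def n)
    moreover have "x \<in> linf K"
      using K by (simp add: mem_linf_iff x)
    ultimately show "d \<in> f ` linf K"
      by blast
  qed
  then have "P \<subseteq> closure (f ` linf K)"
    using D(3) closure_mono by blast
  ultimately show ?thesis
    using fD D(2) by blast
qed

lemma splits_imp_witness:
  fixes K :: "'a::{metric_space, second_countable_topology} kset"
  assumes "splits (set_of_kset K)" "0 < r" "r < 1"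
  shows "\<exists>\<F>. witnesses_generalized_fractal \<F> K \<and>
    (\<forall>f\<in>\<F>. Lip (linf (set_of_kset K)) f \<le> ereal r)"
proof -
  let ?K = "set_of_kset K"
  obtain e U V where e: "0 < e" "split_at e ?K U V"
    using assms(1) by (auto simp: splits_def)
  \<comment> \<open>Balls of this radius cut \<open>K\<close> into pieces of diameter at most
    \<open>r * e\<close>, the bound that the gap \<open>e\<close> can absorb.\<close>
  have "0 < r * e / 2"
    using assms(2) e(1) by simp
  then obtain T where T: "finite T" "T \<subseteq> ?K" "?K \<subseteq> (\<Union>t\<in>T. ball t (r * e / 2))"
    by (rule compact_finite_net[OF compact_set_of_kset])
  define P where "P t = ?K \<inter> ball t (r * e / 2)" for t
  have "\<exists>f. r-lipschitz_on (linf ?K) f \<and> f ` linf ?K \<subseteq> P t \<and> P t \<subseteq> closure (f ` linf ?K)"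
    if "t \<in> T" for t
  proof (rule split_small_piece_image[OF _ e(2,1)])
    show "P t \<noteq> {}"
      using that T(2) \<open>0 < r * e / 2\<close> by (auto simp: P_def)
    fix p q assume "p \<in> P t" "q \<in> P t"
    then show "dist p q \<le> r * e"
      using dist_triangle_half_r[of t p "r * e" q] by (simp add: P_def)
  qed (use assms in \<open>auto simp: compact_imp_bounded\<close>)
  then obtain f where f: "r-lipschitz_on (linf ?K) (f t)" "f t ` linf ?K \<subseteq> P t"
    "P t \<subseteq> closure (f t ` linf ?K)" if "t \<in> T" for t
    by metis
  have "finite (f ` T)"
    using T(1) by simp
  moreover have "r-lipschitz_on (linf ?K) g" if "g \<in> f ` T" for g
    using that f(1) by blast
  moreover have "g ` linf ?K \<subseteq> ?K" if "g \<in> f ` T" for g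
    using that f(2) by (fastforce simp: P_def)
  moreover have "?K \<subseteq> (\<Union>g\<in>f ` T. closure (g ` linf ?K))"
    using T(3) f(3) by (fastforce simp: P_def)
  ultimately show ?thesis
    by (rule witnesses_generalized_fractal_self_maps[OF _ assms(3)])
qed

lemma singleton_imp_witness:
  fixes K :: "'a::metric_space kset"
  assumes "set_of_kset K = {a}" "0 < r" "r < 1"
  shows "\<exists>\<F>. witnesses_generalized_fractal \<F> K \<and>
    (\<forall>f\<in>\<F>. Lip (linf (set_of_kset K)) f \<le> ereal r)"
proof -
  \<comment> \<open>The sequence space must be nonempty for the constant map to have image
    \<open>{a}\<close>.\<close>
  have "const_bcontfun a \<in> linf {a}"
    by (simp add: mem_linf_iff)
  then have "(\<lambda>x. a) ` linf {a} = {a}"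
    by blast
  moreover have "r-lipschitz_on (linf {a}) (\<lambda>x. a)"
    using assms(2) by (auto intro!: lipschitz_onI)
  ultimately show ?thesis
    using witnesses_generalized_fractal_self_maps[of "{\<lambda>x. a}" r K] assms by auto
qed

section \<open>Splitting is stable and dense away from singletons\<close>

text \<open>Points of \<open>L\<close> are attributed to \<open>U\<close> or \<open>V\<close> by
  proximity; each side moves by less than \<open>e / 3\<close>, so a gap of at least
  \<open>e / 3\<close> survives.\<close>

lemma splits_perturb:
  fixes K L :: "'a::metric_space kset"
  assumes "split_at e (set_of_kset K) U V" "dist K L < e / 3"
  shows "splits (set_of_kset L)"
proof -
  let ?K = "set_of_kset K" and ?L = "set_of_kset L"
  have "0 < e"
    using assms(2) zero_le_dist[of K L] by linarith
  \<comment> \<open>The strict bound on the infimum provides an actual point, in either direction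
    between \<open>K\<close> and \<open>L\<close>.\<close>
  have near: "\<exists>b\<in>set_of_kset B. dist a b < e / 3"
    if "dist A B < e / 3" "a \<in> set_of_kset A" for a and A B :: "'a kset"
  proof -
    have "infdist a (set_of_kset B) < e / 3"
      using infdist_le_hausdorff_dist[of "set_of_kset A" a "set_of_kset B"] that
      by (simp add: dist_kset_def)
    then show ?thesis
      unfolding infdist_notempty[OF set_of_kset_nonempty]
      by (subst (asm) cINF_less_iff) auto
  qed
  define nbhd where "nbhd S = {l \<in> ?L. \<exists>s\<in>S. dist s l < e / 3}" for S
  have K: "?K = U \<union> V" "U \<noteq> {}" "V \<noteq> {}"
    using assms(1) by (auto simp: split_at_def)
  have "nbhd S \<noteq> {}" if "S \<subseteq> ?K" "S \<noteq> {}" for S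
  proof -
    obtain s where "s \<in> S"
      using \<open>S \<noteq> {}\<close> by blast
    with that(1) near[OF assms(2), of s] show ?thesis
      unfolding nbhd_def by blast
  qed
  then have "nbhd U \<noteq> {}" "nbhd V \<noteq> {}"
    using K by auto
  moreover have "?L \<subseteq> nbhd U \<union> nbhd V"
  proof
    fix l assume "l \<in> ?L"
    moreover from this obtain k where "k \<in> ?K" "dist k l < e / 3"
      using near[of L K l] assms(2) by (auto simp: dist_commute)
    ultimately show "l \<in> nbhd U \<union> nbhd V"
      unfolding K(1) nbhd_def by blast
  qed
  then have "?L = nbhd U \<union> nbhd V"
    by (auto simp: nbhd_def)
  moreover have "e / 3 \<le> dist a b" if ab: "a \<in> nbhd U" "b \<in> nbhd V" for a b
  proof -
    obtain u v where "u \<in> U" "v \<in> V" "dist u a < e / 3" "dist v b < e / 3"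
      using ab by (auto simp: nbhd_def)
    moreover from this have "e \<le> dist u v"
      using assms(1) by (simp add: split_at_def)
    ultimately show ?thesis
      using dist_triangle[of u v a] dist_triangle[of a v b] by (simp add: dist_commute)
  qed
  ultimately have "split_at (e / 3) ?L (nbhd U) (nbhd V)"
    by (simp add: split_at_def)
  then show ?thesis
    using \<open>0 < e\<close> unfolding splits_def by (intro exI[of _ "e / 3"]) auto
qed

text \<open>A point of a finite set is isolated, so it can be split off from the rest.\<close>

lemma finite_splits:
  assumes "finite F" "a \<in> F" "b \<in> F" "a \<noteq> b"
  shows "splits F"
proof -
  have "closed (F - {a})" "F - {a} \<noteq> {}"
    using assms by (auto simp: finite_imp_closed)
  then have "0 < infdist a (F - {a})"
    by (simp add: infdist_pos_not_in_closed)
  moreover have "split_at (infdist a (F - {a})) F {a} (F - {a})"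
    using assms by (auto simp: split_at_def infdist_le)
  ultimately show ?thesis
    by (auto simp: splits_def)
qed

lemma splits_arbitrarily_close:
  fixes K :: "'a::metric_space kset"
  assumes "a \<in> set_of_kset K" "b \<in> set_of_kset K" "a \<noteq> b" "0 < e"
  shows "\<exists>F. dist K F < e \<and> splits (set_of_kset F)"
proof -
  let ?K = "set_of_kset K"
  have "0 < e / 2"
    using assms(4) by simp
  then obtain T where T: "finite T" "T \<subseteq> ?K" "?K \<subseteq> (\<Union>t\<in>T. ball t (e / 2))"
    by (rule compact_finite_net[OF compact_set_of_kset])
  \<comment> \<open>Adding \<open>a\<close> and \<open>b\<close> guarantees two distinct points even
    if the net has only one.\<close>
  define F where "F = insert a (insert b T)"
  have F: "finite F" "F \<subseteq> ?K" "F \<noteq> {}"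
    using T assms by (auto simp: F_def)
  have "hausdorff_dist ?K F \<le> e / 2"
  proof (rule hausdorff_dist_le)
    fix x assume "x \<in> ?K"
    then obtain t where "t \<in> T" "x \<in> ball t (e / 2)"
      using T(3) by blast
    then have "t \<in> F" "dist x t < e / 2"
      by (auto simp: F_def dist_commute)
    then show "infdist x F \<le> e / 2"
      by (meson infdist_le2 less_imp_le)
  next
    fix x assume "x \<in> F"
    then show "infdist x ?K \<le> e / 2"
      using F(2) assms(4) by (simp add: infdist_zero subsetD)
  qed (use F in auto)
  moreover have "set_of_kset (Abs_kset F) = F"
    using F by (simp add: Abs_kset_inverse finite_imp_compact)
  moreover have "splits F"
    using F(1) assms(3) by (intro finite_splits[of F a b]) (auto simp: F_def)
  ultimately show ?thesis
    using assms(4) by (intro exI[of _ "Abs_kset F"]) (simp add: dist_kset_def)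
qed

section \<open>Baire category\<close>

lemma nowhere_dense_subset:
  assumes "S \<subseteq> T" "nowhere_dense T"
  shows "nowhere_dense S"
  using interior_mono[OF closure_mono[OF assms(1)]] assms(2) by (simp add: nowhere_dense_def)

lemma nowhere_dense_nonsplit:
  "nowhere_dense {K :: 'a::metric_space kset.
     \<not> splits (set_of_kset K) \<and> (\<forall>a. set_of_kset K \<noteq> {a})}" (is "nowhere_dense ?B")
  unfolding nowhere_dense_def
proof (rule ccontr)
  assume "interior (closure ?B) \<noteq> {}"
  then obtain W where W: "open W" "W \<noteq> {}" "W \<subseteq> closure ?B"
    using interior_subset[of "closure ?B"] open_interior[of "closure ?B"] by auto
  \<comment> \<open>A nonempty open set inside the closure of \<open>?B\<close> meets
    \<open>?B\<close> itself.\<close>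
  then obtain K where K: "K \<in> W" "\<forall>a. set_of_kset K \<noteq> {a}"
    using open_Int_closure_eq_empty[of W ?B] by blast
  obtain e where e: "0 < e" "ball K e \<subseteq> W"
    using W(1) K(1) open_contains_ball by blast
  obtain a where a: "a \<in> set_of_kset K"
    using set_of_kset_nonempty by blast
  then obtain b where "b \<in> set_of_kset K" "a \<noteq> b"
    using K(2) by blast
  then obtain F where F: "dist K F < e" "splits (set_of_kset F)"
    using splits_arbitrarily_close a e(1) by blast
  then obtain d U V where d: "0 < d" "split_at d (set_of_kset F) U V"
    by (auto simp: splits_def)
  \<comment> \<open>The split set \<open>F\<close> is a limit of non-split sets, which contradicts
    stability of splitting at scale \<open>d / 3\<close>.\<close>
  have "F \<in> closure ?B"
    using F(1) e(2) W(3) by auto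
  moreover have "0 < d / 3"
    using d(1) by simp
  ultimately obtain L where "L \<in> ?B" "dist L F < d / 3"
    unfolding closure_approachable by blast
  then show False
    using splits_perturb[OF d(2), of L] by (simp add: dist_commute)
qed

theorem corollary5p14:
  shows "comeager {K :: 'a::polish_space kset.
           generalized_fractal K \<and>
           (\<forall>r\<in>{0<..<1::real}. \<exists>\<F>. witnesses_generalized_fractal \<F> K \<and>
              (\<forall>f\<in>\<F>. Lip (linf (set_of_kset K)) f \<le> ereal r))}"
    (is "comeager ?G")
proof -
  have "K \<in> ?G" if "splits (set_of_kset K) \<or> (\<exists>a. set_of_kset K = {a})" for K :: "'a kset"
  proof -
    have "\<exists>\<F>. witnesses_generalized_fractal \<F> K \<and>
      (\<forall>f\<in>\<F>. Lip (linf (set_of_kset K)) f \<le> ereal r)" if "0 < r" "r < 1" for r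
      using \<open>_ \<or> _\<close> splits_imp_witness singleton_imp_witness that by blast
    \<comment> \<open>Any ratio in the unit interval would serve here.\<close>
    moreover from this[of "1/2"] have "generalized_fractal K"
      unfolding generalized_fractal_def by auto
    ultimately show ?thesis
      by simp
  qed
  then have "- ?G \<subseteq> {K. \<not> splits (set_of_kset K) \<and> (\<forall>a. set_of_kset K \<noteq> {a})}"
    by blast
  then have "nowhere_dense (- ?G)"
    by (rule nowhere_dense_subset) (rule nowhere_dense_nonsplit)
  then show ?thesis
    \<comment> \<open>The complement is itself nowhere dense, so a one-element family shows that it
      is meager.\<close>
    unfolding comeager_def meager_def by (intro exI[of _ "{- ?G}"]) auto
qed

end
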